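(* Let $P$ be a program and let $M$ be a set of ground regular atoms over the predicates and constants of $P$. Then $M$ is an answer set of $P$ if and only if $(\mathrm{cts}(P),\, M\cup\{g(a,b)\mid a,b\in\mathrm{cts}(P)\})$ is an open answer set of $P^{\mathrm{g}}$.
   Context: Terms are constants and variables (no function symbols). A literal is an atom $q(\mathbf{t})$ or a naf-atom $\mathrm{not}\,q(\mathbf{t})$. Equality is a binary predicate; $t\neq s$ stands for $\mathrm{not}\,(t=s)$. A regular atom is an atom that is not an equality atom. For a set $\alpha$ of literals, $\alpha^+$ is the set of atoms in $\alpha$ and $\alpha^-=\{a \mid \mathrm{not}\,a\in\alpha\}$; for a set $X$ of atoms, $\mathrm{not}\,X=\{\mathrm{not}\,a\mid a\in X\}$. A rule is $\alpha\leftarrow\beta$ with $\alpha,\beta$ finite sets of literals, $|\alpha^+|\le 1$, and $\alpha^+$ containing no equality atom ($\alpha$ is read disjunctively, $\beta$ conjunctively; $\alpha$ may be empty). A program is a finite set of rules; $\mathrm{cts}(P)$ is the set of constants of $P$, and $P$ is assumed to contain at least one constant. A universe $U$ for $P$ is a non-empty countable superset of $\mathrm{cts}(P)$. $P_U$ is the ground program obtained by substituting variables of $P$ by elements of $U$ in all possible ways. For a set $I$ of ground regular atoms, $I\models a$ iff $a\in I$ for regular $a$; $I\models t=s$ iff $t,s$ are the same element; $I\models \mathrm{not}\,a$ iff $I\not\models a$; $I\models X$ iff $I$ satisfies every element of $X$. $I$ satisfies a ground rule $\alpha\leftarrow\beta$ if $I\models l$ for some $l\in\alpha$ whenever $I\models\beta$.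 For a ground program without $\mathrm{not}$, an answer set is a subset-minimal model. For a ground program $Q$, the GL-reduct is $Q^I=\{\alpha^+\leftarrow\beta^+ \mid \alpha\leftarrow\beta\in Q,\ I\models\mathrm{not}\,\beta^-,\ I\models\alpha^-\}$, and $I$ is an answer set of $Q$ if it is an answer set of $Q^I$. An (ordinary) answer set of $P$ is an answer set of $P_{\mathrm{cts}(P)}$. An open answer set of $P$ is a pair $(U,M)$ with $U$ a universe for $P$, $M$ a set of ground regular atoms over the predicates of $P$ and $U$, and $M$ an answer set of $P_U$. Let $g$ be a binary predicate not occurring in $P$. $P^{\mathrm{g}}$ is the program obtained from $P$ by adding, for each rule $r$ in $P$ and each pair of (not necessarily distinct) variables $X,Y$ in $r$, the atom $g(X,Y)$ to the body of $r$, and by adding the rule $g(a,b)\leftarrow$ for all $a,b\in\mathrm{cts}(P)$. *)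

theory Defs
  imports Main "HOL-Library.Countable_Set"
begin

datatype (trm_cts: 'c, trm_vars: 'v) trm = Const 'c | Var 'v

text \<open>
  A predicate is identified by its name together with its arity, so \<open>Regular q ts\<close> is an
  atom of the predicate \<open>(q, length ts)\<close>. Equality is a constructor of its own and is hence
  never confused with a regular predicate.
\<close>

datatype (dead 'p, atom_cts: 'c, atom_vars: 'v) atom =
    Regular 'p "('c, 'v) trm list"
  | Equality "('c, 'v) trm" "('c, 'v) trm"

datatype (dead 'p, lit_cts: 'c, lit_vars: 'v) lit =
    Pos "('p, 'c, 'v) atom"
  | Naf "('p, 'c, 'v) atom"

datatype ('p, 'c, 'v) rule =
  Rule (head: "('p, 'c, 'v) lit set") (body: "('p, 'c, 'v) lit set")

type_synonym ('p, 'c, 'v) program = "('p, 'c, 'v) rule set"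

definition pos :: "('p, 'c, 'v) lit set \<Rightarrow> ('p, 'c, 'v) atom set" where
  "pos \<alpha> = {a. Pos a \<in> \<alpha>}"

definition neg :: "('p, 'c, 'v) lit set \<Rightarrow> ('p, 'c, 'v) atom set" where
  "neg \<alpha> = {a. Naf a \<in> \<alpha>}"

definition rule_lits :: "('p, 'c, 'v) rule \<Rightarrow> ('p, 'c, 'v) lit set" where
  "rule_lits r = head r \<union> body r"

definition rule_vars :: "('p, 'c, 'v) rule \<Rightarrow> 'v set" where
  "rule_vars r = (\<Union>l \<in> rule_lits r. lit_vars l)"

definition cts :: "('p, 'c, 'v) program \<Rightarrow> 'c set" where
  "cts P = (\<Union>r \<in> P. \<Union>l \<in> rule_lits r. lit_cts l)"

definition preds :: "('p, 'c, 'v) program \<Rightarrow> ('p \<times> nat) set" where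
  "preds P = {(q, length ts) | q ts.
     \<exists>r \<in> P. Pos (Regular q ts) \<in> rule_lits r \<or> Naf (Regular q ts) \<in> rule_lits r}"

definition is_rule :: "('p, 'c, 'v) rule \<Rightarrow> bool" where
  "is_rule r \<longleftrightarrow> finite (head r) \<and> finite (body r) \<and> card (pos (head r)) \<le> 1 \<and>
     (\<forall>t s. Equality t s \<notin> pos (head r))"

definition is_program :: "('p, 'c, 'v) program \<Rightarrow> bool" where
  "is_program P \<longleftrightarrow> finite P \<and> (\<forall>r \<in> P. is_rule r) \<and> cts P \<noteq> {}"

subsection \<open>Grounding\<close>

text \<open>
  Universe elements are taken from the type of constants, so ground programs and ground
  atoms live in the same types as programs and atoms.
\<close>

definition universe :: "('p, 'c, 'v) program \<Rightarrow> 'c set \<Rightarrow> bool" where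
  "universe P U \<longleftrightarrow> U \<noteq> {} \<and> countable U \<and> cts P \<subseteq> U"

fun subst_trm :: "('v \<Rightarrow> 'c) \<Rightarrow> ('c, 'v) trm \<Rightarrow> ('c, 'v) trm" where
  "subst_trm \<sigma> (Const c) = Const c"
| "subst_trm \<sigma> (Var x) = Const (\<sigma> x)"

fun subst_atom :: "('v \<Rightarrow> 'c) \<Rightarrow> ('p, 'c, 'v) atom \<Rightarrow> ('p, 'c, 'v) atom" where
  "subst_atom \<sigma> (Regular q ts) = Regular q (map (subst_trm \<sigma>) ts)"
| "subst_atom \<sigma> (Equality t s) = Equality (subst_trm \<sigma> t) (subst_trm \<sigma> s)"

fun subst_lit :: "('v \<Rightarrow> 'c) \<Rightarrow> ('p, 'c, 'v) lit \<Rightarrow> ('p, 'c, 'v) lit" where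
  "subst_lit \<sigma> (Pos a) = Pos (subst_atom \<sigma> a)"
| "subst_lit \<sigma> (Naf a) = Naf (subst_atom \<sigma> a)"

definition subst_rule :: "('v \<Rightarrow> 'c) \<Rightarrow> ('p, 'c, 'v) rule \<Rightarrow> ('p, 'c, 'v) rule" where
  "subst_rule \<sigma> r = Rule (subst_lit \<sigma> ` head r) (subst_lit \<sigma> ` body r)"

definition grounding :: "('p, 'c, 'v) program \<Rightarrow> 'c set \<Rightarrow> ('p, 'c, 'v) program" where
  "grounding P U = {subst_rule \<sigma> r | \<sigma> r. r \<in> P \<and> (\<forall>x \<in> rule_vars r. \<sigma> x \<in> U)}"

definition ground_regular_atoms :: "('p, 'c, 'v) atom set" where
  "ground_regular_atoms = {Regular q (map Const cs) | q cs. True}"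

definition ground_regular_atoms_over :: "('p \<times> nat) set \<Rightarrow> 'c set \<Rightarrow> ('p, 'c, 'v) atom set" where
  "ground_regular_atoms_over Q C =
     {Regular q (map Const cs) | q cs. (q, length cs) \<in> Q \<and> set cs \<subseteq> C}"

subsection \<open>Satisfaction and answer sets\<close>

fun sat_atom :: "('p, 'c, 'v) atom set \<Rightarrow> ('p, 'c, 'v) atom \<Rightarrow> bool" where
  "sat_atom I (Regular q ts) \<longleftrightarrow> Regular q ts \<in> I"
| "sat_atom I (Equality t s) \<longleftrightarrow> t = s"

fun sat_lit :: "('p, 'c, 'v) atom set \<Rightarrow> ('p, 'c, 'v) lit \<Rightarrow> bool" where
  "sat_lit I (Pos a) \<longleftrightarrow> sat_atom I a"
| "sat_lit I (Naf a) \<longleftrightarrow> \<not> sat_atom I a"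

definition sat_lits :: "('p, 'c, 'v) atom set \<Rightarrow> ('p, 'c, 'v) lit set \<Rightarrow> bool" where
  "sat_lits I X \<longleftrightarrow> (\<forall>l \<in> X. sat_lit I l)"

definition sat_rule :: "('p, 'c, 'v) atom set \<Rightarrow> ('p, 'c, 'v) rule \<Rightarrow> bool" where
  "sat_rule I r \<longleftrightarrow> (sat_lits I (body r) \<longrightarrow> (\<exists>l \<in> head r. sat_lit I l))"

definition is_model :: "('p, 'c, 'v) program \<Rightarrow> ('p, 'c, 'v) atom set \<Rightarrow> bool" where
  "is_model Q I \<longleftrightarrow> I \<subseteq> ground_regular_atoms \<and> (\<forall>r \<in> Q. sat_rule I r)"

definition minimal_model :: "('p, 'c, 'v) program \<Rightarrow> ('p, 'c, 'v) atom set \<Rightarrow> bool" where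
  "minimal_model Q I \<longleftrightarrow> is_model Q I \<and> (\<forall>J. J \<subset> I \<longrightarrow> \<not> is_model Q J)"

definition gl_reduct ::
  "('p, 'c, 'v) program \<Rightarrow> ('p, 'c, 'v) atom set \<Rightarrow> ('p, 'c, 'v) program" where
  "gl_reduct Q I = {Rule (Pos ` pos (head r)) (Pos ` pos (body r)) | r.
     r \<in> Q \<and> sat_lits I (Naf ` neg (body r)) \<and> sat_lits I (Pos ` neg (head r))}"

definition ground_answer_set :: "('p, 'c, 'v) program \<Rightarrow> ('p, 'c, 'v) atom set \<Rightarrow> bool" where
  "ground_answer_set Q I \<longleftrightarrow> minimal_model (gl_reduct Q I) I"

definition answer_set :: "('p, 'c, 'v) program \<Rightarrow> ('p, 'c, 'v) atom set \<Rightarrow> bool" where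
  "answer_set P M \<longleftrightarrow> ground_answer_set (grounding P (cts P)) M"

fun open_answer_set ::
  "('p, 'c, 'v) program \<Rightarrow> 'c set \<times> ('p, 'c, 'v) atom set \<Rightarrow> bool" where
  "open_answer_set P (U, M) \<longleftrightarrow>
     universe P U \<and> M \<subseteq> ground_regular_atoms_over (preds P) U \<and>
     ground_answer_set (grounding P U) M"

subsection \<open>The guarded program\<close>

definition guard_rule :: "'p \<Rightarrow> ('p, 'c, 'v) rule \<Rightarrow> ('p, 'c, 'v) rule" where
  "guard_rule g r = Rule (head r)
     (body r \<union> {Pos (Regular g [Var x, Var y]) | x y. x \<in> rule_vars r \<and> y \<in> rule_vars r})"

definition guarded_program :: "'p \<Rightarrow> ('p, 'c, 'v) program \<Rightarrow> ('p, 'c, 'v) program" where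
  "guarded_program g P = guard_rule g ` P \<union>
     {Rule {Pos (Regular g [Const a, Const b])} {} | a b. a \<in> cts P \<and> b \<in> cts P}"

end

(* The guards restrict the variables of a rule to cts P, which is what grounding over cts P
   does anyway. Writing G for the facts g(a,b), the models of the reduct of the guarded program
   are exactly the sets J that contain G and whose remainder J - G is a model of the reduct of
   P; hence adding and removing G exchanges the minimal models. *)

theory Submission
  imports Defs
begin

text \<open>The set \<open>C\<close> is a parameter because two instances occur:
  \<open>cts P\<close> gives the added facts, and the values of a substitution on the variables of a
  rule give the guards of a ground instance.\<close>

definition guard_atoms :: "'p \<Rightarrow> 'c set \<Rightarrow> ('p, 'c, 'v) atom set" where
  "guard_atoms g C = {Regular g [Const a, Const b] | a b. a \<in> C \<and> b \<in> C}"

lemma guard_atoms_ground: "(guard_atoms g C :: ('p, 'c, 'v) atom set) \<subseteq> ground_regular_atoms"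
proof
  fix x :: "('p, 'c, 'v) atom"
  assume "x \<in> guard_atoms g C"
  then obtain a b where "x = Regular g (map Const [a, b])"
    by (auto simp: guard_atoms_def)
  then show "x \<in> ground_regular_atoms"
    unfolding ground_regular_atoms_def by blast
qed

lemma guard_atoms_over:
  assumes "(g, 2) \<in> Q"
  shows "(guard_atoms g C :: ('p, 'c, 'v) atom set) \<subseteq> ground_regular_atoms_over Q C"
proof
  fix x :: "('p, 'c, 'v) atom"
  assume "x \<in> guard_atoms g C"
  then obtain a b where "x = Regular g (map Const [a, b])" "a \<in> C" "b \<in> C"
    by (auto simp: guard_atoms_def)
  moreover have "(g, length [a, b]) \<in> Q" "set [a, b] \<subseteq> C"
    using assms \<open>a \<in> C\<close> \<open>b \<in> C\<close> by (auto simp: numeral_2_eq_2)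
  ultimately show "x \<in> ground_regular_atoms_over Q C"
    unfolding ground_regular_atoms_over_def by blast
qed

lemma ground_regular_atoms_over_mono:
  "Q \<subseteq> Q' \<Longrightarrow> ground_regular_atoms_over Q C \<subseteq> ground_regular_atoms_over Q' C"
  unfolding ground_regular_atoms_over_def by blast

lemma guard_atoms_arity:
  assumes "a \<in> guard_atoms g C"
  obtains ts where "a = Regular g ts" "length ts = 2"
  using assms by (fastforce simp: guard_atoms_def)

text \<open>Predicates are pairs of name and arity, so \<open>Q\<close> may contain the name
  \<open>g\<close> at other arities; it is the length of the argument list that separates the two
  sets.\<close>

lemma ground_regular_atoms_over_disjoint_guard_atoms:
  assumes "(g, 2) \<notin> Q"
  shows "ground_regular_atoms_over Q C \<inter> guard_atoms g D = {}"
  using assms by (auto simp: ground_regular_atoms_over_def elim!: guard_atoms_arity)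

section \<open>Constants and predicates of the guarded program\<close>

lemma finite_trm_cts: "finite (trm_cts t)"
  by (cases t) auto

lemma finite_atom_cts: "finite (atom_cts a)"
  by (cases a) (auto simp: finite_trm_cts)

lemma finite_lit_cts: "finite (lit_cts l)"
  by (cases l) (auto simp: finite_atom_cts)

text \<open>Supplies the countability that \<open>cts P\<close> needs in order to be a
  universe.\<close>

lemma finite_cts: "is_program P \<Longrightarrow> finite (cts P)"
  by (auto simp: is_program_def is_rule_def cts_def rule_lits_def finite_lit_cts)

lemma cts_Un: "cts (P \<union> Q) = cts P \<union> cts Q"
  by (auto simp: cts_def)

text \<open>Guards contain only variables, and the facts mention only constants of
  \<open>P\<close>.\<close>

lemma cts_guarded_program: "cts (guarded_program g P) = cts P"
proof -
  have "cts (guard_rule g ` P) = cts P"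
    by (fastforce simp: cts_def rule_lits_def guard_rule_def)
  moreover have "cts {Rule {Pos (Regular g [Const a, Const b])} {} | a b.
      a \<in> cts P \<and> b \<in> cts P} \<subseteq> cts P"
    by (auto simp: cts_def[of "Collect _"] rule_lits_def)
  ultimately show ?thesis
    unfolding guarded_program_def cts_Un by blast
qed

lemma in_predsI:
  assumes "r \<in> P" "Pos (Regular q ts) \<in> rule_lits r \<or> Naf (Regular q ts) \<in> rule_lits r"
  shows "(q, length ts) \<in> preds P"
  using assms unfolding preds_def by blast

lemma preds_subset_guarded_program: "preds P \<subseteq> preds (guarded_program g P)"
proof
  fix x
  assume "x \<in> preds P"
  then obtain q ts r where x: "x = (q, length ts)" and "r \<in> P"
    and "Pos (Regular q ts) \<in> rule_lits r \<or> Naf (Regular q ts) \<in> rule_lits r"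
    unfolding preds_def by blast
  moreover from this have "guard_rule g r \<in> guarded_program g P"
    by (simp add: guarded_program_def)
  moreover have "rule_lits r \<subseteq> rule_lits (guard_rule g r)"
    by (auto simp: rule_lits_def guard_rule_def)
  ultimately show "x \<in> preds (guarded_program g P)"
    unfolding x by (intro in_predsI[of "guard_rule g r"]) blast+
qed

text \<open>The witness is a fact, not a guard: a program without variables has no guards, but one
  constant already yields \<open>g(a,a)\<close>.\<close>

lemma guard_in_preds_guarded_program:
  assumes "cts P \<noteq> {}"
  shows "(g, 2) \<in> preds (guarded_program g P)"
proof -
  obtain a where "a \<in> cts P"
    using assms by blast
  then have "Rule {Pos (Regular g [Const a, Const a])} {} \<in> guarded_program g P"
    by (auto simp: guarded_program_def)
  from in_predsI[OF this, of g "[Const a, Const a]"] show ?thesis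
    by (simp add: rule_lits_def numeral_2_eq_2)
qed

lemma subst_atom_RegularE:
  assumes "subst_atom \<sigma> a = Regular q ts"
  obtains us where "a = Regular q us" "length us = length ts"
  using assms by (cases a) auto

text \<open>Substitution changes terms only and keeps names and arities, so the absence of
  \<open>g\<close> carries over to ground instances.\<close>

lemma preds_grounding: "preds (grounding P U) \<subseteq> preds P"
proof
  fix x
  assume "x \<in> preds (grounding P U)"
  then obtain q ts \<sigma> r where x: "x = (q, length ts)" and r: "r \<in> P"
    and lit: "Pos (Regular q ts) \<in> rule_lits (subst_rule \<sigma> r) \<or>
      Naf (Regular q ts) \<in> rule_lits (subst_rule \<sigma> r)"
    by (auto simp: preds_def grounding_def)
  have "rule_lits (subst_rule \<sigma> r) = subst_lit \<sigma> ` rule_lits r"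
    by (auto simp: rule_lits_def subst_rule_def)
  then obtain l where l: "l \<in> rule_lits r"
    and "subst_lit \<sigma> l = Pos (Regular q ts) \<or> subst_lit \<sigma> l = Naf (Regular q ts)"
    using lit by (metis imageE)
  then obtain a where a: "subst_atom \<sigma> a = Regular q ts" "l = Pos a \<or> l = Naf a"
    by (cases l) auto
  then obtain us where "a = Regular q us" "length us = length ts"
    by (auto elim: subst_atom_RegularE)
  then show "x \<in> preds P"
    using in_predsI[OF r, of q us] x l a(2) by auto
qed

lemma guard_free_rule_atoms:
  assumes "(g, 2) \<notin> preds Q" "r \<in> Q"
    and "a \<in> pos (head r) \<union> neg (head r) \<union> pos (body r) \<union> neg (body r)"
  shows "a \<notin> guard_atoms g C"
proof
  assume "a \<in> guard_atoms g C"
  then obtain ts where a: "a = Regular g ts" and len: "length ts = 2"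
    by (rule guard_atoms_arity)
  have "Pos a \<in> rule_lits r \<or> Naf a \<in> rule_lits r"
    using assms(3) by (auto simp: pos_def neg_def rule_lits_def)
  then show False
    using in_predsI[OF assms(2), of g ts] assms(1) a len by simp
qed

section \<open>Satisfaction of the reduct\<close>

lemma sat_atom_Diff: "a \<notin> G \<Longrightarrow> sat_atom (J - G) a \<longleftrightarrow> sat_atom J a"
  by (cases a) auto

lemma sat_atom_Un: "a \<notin> G \<Longrightarrow> sat_atom (J \<union> G) a \<longleftrightarrow> sat_atom J a"
  by (cases a) auto

text \<open>Says that \<open>J\<close> satisfies whatever the reduct by \<open>I\<close> keeps of
  \<open>r\<close>, without forming the reduct: \<open>I\<close> evaluates the naf part,
  \<open>J\<close> the positive part, and a deleted rule holds vacuously.\<close>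

definition reduct_sat ::
  "('p, 'c, 'v) atom set \<Rightarrow> ('p, 'c, 'v) atom set \<Rightarrow> ('p, 'c, 'v) rule \<Rightarrow> bool" where
  "reduct_sat I J r \<longleftrightarrow>
     (\<forall>a \<in> neg (body r). \<not> sat_atom I a) \<longrightarrow> (\<forall>a \<in> neg (head r). sat_atom I a) \<longrightarrow>
     (\<forall>a \<in> pos (body r). sat_atom J a) \<longrightarrow> (\<exists>a \<in> pos (head r). sat_atom J a)"

lemma is_model_gl_reduct:
  "is_model (gl_reduct Q I) J \<longleftrightarrow> J \<subseteq> ground_regular_atoms \<and> (\<forall>r \<in> Q. reduct_sat I J r)"
proof -
  have sat: "sat_rule J (Rule (Pos ` pos (head r)) (Pos ` pos (body r))) \<longleftrightarrow>
      (\<forall>a \<in> pos (body r). sat_atom J a) \<longrightarrow> (\<exists>a \<in> pos (head r). sat_atom J a)" for r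
    by (simp add: sat_rule_def sat_lits_def)
  have "(\<forall>r' \<in> gl_reduct Q I. sat_rule J r') \<longleftrightarrow>
      (\<forall>r \<in> Q. sat_lits I (Naf ` neg (body r)) \<longrightarrow> sat_lits I (Pos ` neg (head r)) \<longrightarrow>
        sat_rule J (Rule (Pos ` pos (head r)) (Pos ` pos (body r))))"
    unfolding gl_reduct_def by blast
  then show ?thesis
    by (simp add: is_model_def sat sat_lits_def reduct_sat_def)
qed

section \<open>Grounding the guarded program\<close>

lemma rule_vars_guard_rule: "rule_vars (guard_rule g r) = rule_vars r"
  by (auto simp: rule_vars_def guard_rule_def rule_lits_def)

lemma ball_grounding:
  "(\<forall>r \<in> grounding P U. \<phi> r) \<longleftrightarrow>
     (\<forall>r \<in> P. \<forall>\<sigma>. (\<forall>x \<in> rule_vars r. \<sigma> x \<in> U) \<longrightarrow> \<phi> (subst_rule \<sigma> r))"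
  unfolding grounding_def by blast

text \<open>Guards add no variables, so guarded rules are instantiated by the same substitutions as
  the original ones; the facts are ground and instantiate to themselves.\<close>

lemma ball_grounding_guarded_program:
  "(\<forall>r \<in> grounding (guarded_program g P) U. \<phi> r) \<longleftrightarrow>
     (\<forall>r \<in> P. \<forall>\<sigma>. (\<forall>x \<in> rule_vars r. \<sigma> x \<in> U) \<longrightarrow> \<phi> (subst_rule \<sigma> (guard_rule g r))) \<and>
     (\<forall>a \<in> guard_atoms g (cts P). \<phi> (Rule {Pos a} {}))"
proof -
  have fact_vars: "rule_vars (Rule {Pos a} {}) = {}"
    and fact_subst: "subst_rule \<sigma> (Rule {Pos a} {}) = Rule {Pos a} {}"
    if "a \<in> guard_atoms g (cts P)" for a \<sigma>
    using that by (auto simp: guard_atoms_def rule_vars_def rule_lits_def subst_rule_def)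
  have "guarded_program g P = guard_rule g ` P \<union> (\<lambda>a. Rule {Pos a} {}) ` guard_atoms g (cts P)"
    unfolding guarded_program_def guard_atoms_def by blast
  then show ?thesis
    by (simp add: ball_grounding ball_Un rule_vars_guard_rule fact_vars fact_subst)
qed

lemma subst_guard_rule:
  "subst_rule \<sigma> (guard_rule g r) =
     Rule (head (subst_rule \<sigma> r))
       (body (subst_rule \<sigma> r) \<union> Pos ` guard_atoms g (\<sigma> ` rule_vars r))"
  unfolding subst_rule_def guard_rule_def guard_atoms_def
  by (simp add: image_Un) force

lemma pos_guarded_body: "pos (B \<union> Pos ` A) = pos B \<union> A"
  and neg_guarded_body: "neg (B \<union> Pos ` A) = neg B"
  by (auto simp: pos_def neg_def)

lemma reduct_sat_fact: "a \<in> guard_atoms g C \<Longrightarrow> reduct_sat I J (Rule {Pos a} {}) \<longleftrightarrow> a \<in> J"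
  by (auto simp: reduct_sat_def pos_def neg_def guard_atoms_def)

lemma reduct_sat_guard_rule:
  assumes "(g, 2) \<notin> preds P" "r \<in> P" "\<forall>x \<in> rule_vars r. \<sigma> x \<in> C" "guard_atoms g C \<subseteq> J"
  shows "reduct_sat (I \<union> guard_atoms g C) J (subst_rule \<sigma> (guard_rule g r)) \<longleftrightarrow>
    reduct_sat I (J - guard_atoms g C) (subst_rule \<sigma> r)"
proof -
  let ?G = "guard_atoms g C" and ?r = "subst_rule \<sigma> r"
  \<comment> \<open>The singleton program transfers the absence of the guard predicate from
    \<open>P\<close> to this one ground instance.\<close>
  have "(g, 2) \<notin> preds {?r}"
  proof -
    have "{?r} \<subseteq> grounding P C"
      using assms(2,3) by (auto simp: grounding_def)
    then have "preds {?r} \<subseteq> preds (grounding P C)"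
      unfolding preds_def by blast
    then show ?thesis
      using preds_grounding[of P C] assms(1) by blast
  qed
  then have free: "a \<notin> ?G"
    if "a \<in> pos (head ?r) \<union> neg (head ?r) \<union> pos (body ?r) \<union> neg (body ?r)" for a
    using guard_free_rule_atoms[of g "{?r}" ?r a C] that by simp
  have "guard_atoms g (\<sigma> ` rule_vars r) \<subseteq> ?G"
    using assms(3) by (auto simp: guard_atoms_def)
  then have "\<forall>a \<in> guard_atoms g (\<sigma> ` rule_vars r). a \<in> J"
    using assms(4) by blast
  then have "\<forall>a \<in> guard_atoms g (\<sigma> ` rule_vars r). sat_atom J a"
    by (auto simp: guard_atoms_def)
  then show ?thesis
    by (simp add: reduct_sat_def subst_guard_rule pos_guarded_body neg_guarded_body ball_Un
        sat_atom_Un sat_atom_Diff free)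
qed

text \<open>The facts survive every reduct and force \<open>G \<subseteq> J\<close>; once this
  holds, each guarded instance amounts to the original instance evaluated in
  \<open>J - G\<close>.\<close>

lemma is_model_gl_reduct_guarded_program:
  assumes "(g, 2) \<notin> preds P"
  defines "G \<equiv> guard_atoms g (cts P)"
  shows "is_model (gl_reduct (grounding (guarded_program g P) (cts P)) (I \<union> G)) J \<longleftrightarrow>
    G \<subseteq> J \<and> is_model (gl_reduct (grounding P (cts P)) I) (J - G)"
proof (cases "G \<subseteq> J")
  case True
  have "J \<subseteq> ground_regular_atoms \<longleftrightarrow> J - G \<subseteq> ground_regular_atoms"
    using guard_atoms_ground[of g "cts P"] unfolding G_def by blast
  moreover have "(\<forall>r \<in> grounding (guarded_program g P) (cts P). reduct_sat (I \<union> G) J r) \<longleftrightarrow>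
      (\<forall>r \<in> grounding P (cts P). reduct_sat I (J - G) r)"
    using True reduct_sat_guard_rule[OF assms(1), of _ _ "cts P" J I]
    unfolding ball_grounding_guarded_program ball_grounding[of P] G_def
    by (simp add: reduct_sat_fact subset_iff)
  ultimately show ?thesis
    using True by (simp add: is_model_gl_reduct)
next
  \<comment> \<open>Some fact is violated by \<open>J\<close>, so both sides fail.\<close>
  case False
  then show ?thesis
    by (auto simp: is_model_gl_reduct ball_grounding_guarded_program G_def reduct_sat_fact)
qed

text \<open>Removing and adding \<open>G\<close> are mutually inverse, inclusion-preserving maps
  between the models of \<open>Q'\<close> and the models of \<open>Q\<close> disjoint from
  \<open>G\<close>. Every subset of \<open>M\<close> is disjoint from \<open>G\<close>, so smaller
  models correspond.\<close>

lemma minimal_model_Un_iff: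
  assumes "M \<inter> G = {}"
    and models: "\<And>J. is_model Q' J \<longleftrightarrow> G \<subseteq> J \<and> is_model Q (J - G)"
  shows "minimal_model Q' (M \<union> G) \<longleftrightarrow> minimal_model Q M"
proof -
  have rem: "(J \<union> G) - G = J" if "J \<subseteq> M" for J
    using that assms(1) by blast
  have "(\<exists>J. J \<subset> M \<union> G \<and> is_model Q' J) \<longleftrightarrow> (\<exists>J. J \<subset> M \<and> is_model Q J)"
  proof
    assume "\<exists>J. J \<subset> M \<union> G \<and> is_model Q' J"
    then obtain J where "J \<subset> M \<union> G" "G \<subseteq> J" "is_model Q (J - G)"
      using models by blast
    \<comment> \<open>Strictness survives: an element of \<open>M \<union> G\<close> missing from
      \<open>J\<close> cannot lie in \<open>G\<close>, hence lies in \<open>M\<close>.\<close>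
    then show "\<exists>J. J \<subset> M \<and> is_model Q J"
      by (intro exI[of _ "J - G"]) blast
  next
    assume "\<exists>J. J \<subset> M \<and> is_model Q J"
    then obtain J where "J \<subset> M" "is_model Q J"
      by blast
    \<comment> \<open>Here disjointness keeps the inclusion strict: an element of
      \<open>M - J\<close> is not restored by adding \<open>G\<close>.\<close>
    moreover from this have "J \<union> G \<subset> M \<union> G"
      using assms(1) by blast
    ultimately show "\<exists>J. J \<subset> M \<union> G \<and> is_model Q' J"
      using models rem[of J] by (intro exI[of _ "J \<union> G"]) auto
  qed
  then show ?thesis
    using models[of "M \<union> G"] rem[of M] unfolding minimal_model_def by auto
qed

theorem theorem4p18:
  fixes P :: "('p, 'c, 'v) program"
    and M :: "('p, 'c, 'v) atom set"
    and g :: 'p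
  assumes "is_program P"
    and "(g, 2) \<notin> preds P"
    and "M \<subseteq> ground_regular_atoms_over (preds P) (cts P)"
  shows "answer_set P M \<longleftrightarrow>
    open_answer_set (guarded_program g P)
      (cts P, M \<union> {Regular g [Const a, Const b] | a b. a \<in> cts P \<and> b \<in> cts P})"
proof -
  let ?G = "guard_atoms g (cts P) :: ('p, 'c, 'v) atom set"
  have nonempty: "cts P \<noteq> {}"
    using assms(1) by (simp add: is_program_def)
  then have "universe (guarded_program g P) (cts P)"
    by (simp add: universe_def cts_guarded_program countable_finite finite_cts assms(1))
  moreover have "M \<union> ?G \<subseteq> ground_regular_atoms_over (preds (guarded_program g P)) (cts P)"
    using order_trans[OF assms(3) ground_regular_atoms_over_mono[OF preds_subset_guarded_program]]
      guard_atoms_over[OF guard_in_preds_guarded_program[OF nonempty]]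
    by (rule Un_least)
  moreover have "M \<inter> ?G = {}"
    using assms(3) ground_regular_atoms_over_disjoint_guard_atoms[OF assms(2), of "cts P" "cts P"]
    by blast
  then have "ground_answer_set (grounding (guarded_program g P) (cts P)) (M \<union> ?G) \<longleftrightarrow>
      answer_set P M"
    unfolding answer_set_def ground_answer_set_def
    by (rule minimal_model_Un_iff) (rule is_model_gl_reduct_guarded_program[OF assms(2)])
  ultimately show ?thesis
    by (simp flip: guard_atoms_def)
qed

end
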